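(* Let $0<\varepsilon\leq 1$. There is a deterministic polynomial-time (Karp) reduction from the subset-sum problem $\mathsf{SS}$ to $(2-\varepsilon)$-$\mathsf{GapSVP}_{\infty}$ that reduces instances with $n$ weights to instances with a lattice of rank $O_{\varepsilon}(n)$ (i.e. at most a constant depending only on $\varepsilon$ times $n$).
   Context: $\mathbb{N}$ denotes the positive integers. Subset-sum problem $\mathsf{SS}$: given $s\in\mathbb{N}$ and non-negative integers $a_1,\ldots,a_n$ (the weights), decide whether there exists $(x_1,\ldots,x_n)\in\{0,1\}^n$ with $\sum_{i=1}^n a_ix_i=s$ (YES-instance) or not (NO-instance). A lattice $\mathcal{L}$ of rank $n$ and dimension $m$ is the set of all integer linear combinations of linearly independent vectors $\mathbf{b}_1,\ldots,\mathbf{b}_n\in\mathbb{R}^m$. Let $\|\mathbf{x}\|_\infty=\max_i|x_i|$ and $\lambda_{1,\infty}(\mathcal{L})=\min_{\mathbf{v}\in\mathcal{L}\setminus\{0\}}\|\mathbf{v}\|_\infty$. For $\gamma\ge1$, the promise problem $\gamma$-$\mathsf{GapSVP}_\infty$ is: given a lattice $\mathcal{L}$ and a distance threshold $\delta>0$, decide whether $\lambda_{1,\infty}(\mathcal{L})\le\delta$ (YES-instance) or $\lambda_{1,\infty}(\mathcal{L})>\gamma\delta$ (NO-instance), when one of these cases is promised to hold. A reduction to a promise problem maps YES-instances to YES-instances and NO-instances to NO-instances. *)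

theory Defs
  imports
    "Jordan_Normal_Form.VS_Connect"
    "HOL-Computational_Algebra.Polynomial"
begin

section \<open>Deterministic multi-tape Turing machines\<close>

text \<open>
  Tapes are infinite in both directions. Tape symbols are natural numbers and 0 is the blank.
  A machine uses the symbols below \<open>tm_symbols\<close> and the states below \<open>tm_states\<close>; it starts in
  state 0 and halts when it enters the state \<open>tm_states\<close>. Given the state and the symbols under the
  heads, the transition function yields the next state and, for each tape, the symbol to write and
  the head movement. Only its values on the finitely many legal arguments matter, so a well-formed
  machine amounts to a finite table.
\<close>

datatype movement = Left | Stay | Right

record turing_machine =
  tm_tapes :: nat
  tm_symbols :: nat
  tm_states :: nat
  tm_trans :: "nat \<Rightarrow> nat list \<Rightarrow> nat \<times> (nat \<times> movement) list"

definition tm_wf :: "turing_machine \<Rightarrow> bool" where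
  "tm_wf M \<longleftrightarrow> tm_tapes M \<ge> 2 \<and>
     (\<forall>q rs q' as.
        q < tm_states M \<longrightarrow> length rs = tm_tapes M \<longrightarrow> set rs \<subseteq> {..<tm_symbols M} \<longrightarrow>
        tm_trans M q rs = (q', as) \<longrightarrow>
        q' \<le> tm_states M \<and> length as = tm_tapes M \<and> fst ` set as \<subseteq> {..<tm_symbols M})"

type_synonym tape = "(int \<Rightarrow> nat) \<times> int"  \<comment> \<open>contents and head position\<close>
type_synonym config = "nat \<times> tape list"

fun head_symbol :: "tape \<Rightarrow> nat" where
  "head_symbol (c, h) = c h"

fun move_head :: "movement \<Rightarrow> int \<Rightarrow> int" where
  "move_head Left h = h - 1"
| "move_head Stay h = h"
| "move_head Right h = h + 1"

fun tape_action :: "nat \<times> movement \<Rightarrow> tape \<Rightarrow> tape" where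
  "tape_action (a, d) (c, h) = (c(h := a), move_head d h)"

definition tm_step :: "turing_machine \<Rightarrow> config \<Rightarrow> config" where
  "tm_step M = (\<lambda>(q, ts).
     if q < tm_states M
     then let (q', as) = tm_trans M q (map head_symbol ts) in (q', map2 tape_action as ts)
     else (q, ts))"

definition word_content :: "nat list \<Rightarrow> int \<Rightarrow> nat" where
  "word_content w i = (if 0 \<le> i \<and> i < int (length w) then w ! nat i else 0)"

definition tm_init :: "turing_machine \<Rightarrow> nat list \<Rightarrow> config" where
  "tm_init M w = (0, (word_content w, 0) # replicate (tm_tapes M - 1) (word_content [], 0))"

text \<open>
  The input is on tape 0 and the output on tape 1. A halting configuration does not change any
  more, so having halted after exactly \<open>t\<close> steps means having halted within \<open>t\<close> steps.
\<close>

definition tm_outputs_within :: "turing_machine \<Rightarrow> nat list \<Rightarrow> nat list \<Rightarrow> nat \<Rightarrow> bool" where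
  "tm_outputs_within M w v t \<longleftrightarrow>
     (\<exists>ts. (tm_step M ^^ t) (tm_init M w) = (tm_states M, ts) \<and> fst (ts ! 1) = word_content v)"

definition polytime_computable_on ::
  "'a set \<Rightarrow> ('a \<Rightarrow> nat list) \<Rightarrow> ('b \<Rightarrow> nat list) \<Rightarrow> ('a \<Rightarrow> 'b) \<Rightarrow> bool" where
  "polytime_computable_on A encA encB f \<longleftrightarrow>
     (\<exists>M (p :: nat poly). tm_wf M \<and>
        (\<forall>x\<in>A. set (encA x) \<union> set (encB (f x)) \<subseteq> {1..<tm_symbols M} \<and>
               tm_outputs_within M (encA x) (encB (f x)) (poly p (length (encA x)))))"


section \<open>Promise problems and Karp reductions\<close>

text \<open>A promise problem is the pair of its sets of YES- and NO-instances.\<close>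

type_synonym 'a promise_problem = "'a set \<times> 'a set"

definition karp_reduction ::
  "('a \<Rightarrow> nat list) \<Rightarrow> 'a promise_problem \<Rightarrow> ('b \<Rightarrow> nat list) \<Rightarrow> 'b promise_problem
     \<Rightarrow> ('a \<Rightarrow> 'b) \<Rightarrow> bool" where
  "karp_reduction encA P encB Q f \<longleftrightarrow>
     polytime_computable_on (fst P \<union> snd P) encA encB f \<and>
     (\<forall>x\<in>fst P. f x \<in> fst Q) \<and> (\<forall>x\<in>snd P. f x \<in> snd Q)"


section \<open>Encoding of instances\<close>

text \<open>
  Symbols: 1 and 2 are the binary digits 0 and 1, 3 is the minus sign, 4 the fraction bar, 5 ends a
  number in a list and 6 ends a vector. Numbers are written in binary, least significant digit
  first and without superfluous zeros, so that 0 is the empty word. Rationals are written as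
  reduced fractions with positive denominator.
\<close>

fun enc_nat :: "nat \<Rightarrow> nat list" where
  "enc_nat n = (if n = 0 then [] else (if even n then 1 else 2) # enc_nat (n div 2))"

declare enc_nat.simps [simp del]

definition enc_int :: "int \<Rightarrow> nat list" where
  "enc_int z = (if z < 0 then [3] else []) @ enc_nat (nat \<bar>z\<bar>)"

definition enc_rat :: "rat \<Rightarrow> nat list" where
  "enc_rat r = (case quotient_of r of (a, b) \<Rightarrow> enc_int a @ [4] @ enc_nat (nat b))"

definition enc_rat_vec :: "rat vec \<Rightarrow> nat list" where
  "enc_rat_vec v = concat (map (\<lambda>r. enc_rat r @ [5]) (list_of_vec v)) @ [6]"


section \<open>Subset sum\<close>

type_synonym ss_instance = "nat \<times> nat list"  \<comment> \<open>target and weights\<close>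

definition enc_ss :: "ss_instance \<Rightarrow> nat list" where
  "enc_ss = (\<lambda>(s, as). concat (map (\<lambda>a. enc_nat a @ [5]) (s # as)))"

definition has_subset_sum :: "ss_instance \<Rightarrow> bool" where
  "has_subset_sum = (\<lambda>(s, as).
     \<exists>x :: nat \<Rightarrow> nat. (\<forall>i<length as. x i \<in> {0, 1}) \<and> (\<Sum>i<length as. as ! i * x i) = s)"

definition SS :: "ss_instance promise_problem" where
  "SS = ({(s, as). 0 < s \<and> has_subset_sum (s, as)}, {(s, as). 0 < s \<and> \<not> has_subset_sum (s, as)})"


section \<open>Lattices and the shortest vector problem in the maximum norm\<close>

text \<open>The lattice generated by a list of vectors is \<^const>\<open>vec_module.lattice_of\<close>.\<close>

definition lattice_basis :: "nat \<Rightarrow> real vec list \<Rightarrow> bool" where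
  "lattice_basis m bs \<longleftrightarrow> set bs \<subseteq> carrier_vec m \<and> distinct bs \<and>
     module.lin_indpt class_ring (module_vec TYPE(real) m) (set bs)"

definition linf_norm :: "real vec \<Rightarrow> real" where
  "linf_norm v = Max ((\<lambda>i. \<bar>v $ i\<bar>) ` {..<dim_vec v})"

text \<open>
  For the lattice of a nonempty basis the infimum is attained, since lattices are discrete.
\<close>

definition lambda1_inf :: "nat \<Rightarrow> real vec set \<Rightarrow> real" where
  "lambda1_inf m L = Inf (linf_norm ` (L - {0\<^sub>v m}))"

text \<open>
  For an input to be a finite object, the basis vectors and the distance threshold are rational.
  The rank is positive, as the minimum distance of the zero lattice is undefined. The encoding
  need not contain the dimension, which is the length of each basis vector.
\<close>

record gapsvp_instance =
  dimension :: nat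
  basis :: "rat vec list"
  threshold :: rat

definition real_basis :: "gapsvp_instance \<Rightarrow> real vec list" where
  "real_basis I = map (map_vec of_rat) (basis I)"

definition lattice_rank :: "gapsvp_instance \<Rightarrow> nat" where
  "lattice_rank I = length (basis I)"

definition min_dist :: "gapsvp_instance \<Rightarrow> real" where
  "min_dist I = lambda1_inf (dimension I) (vec_module.lattice_of (dimension I) (real_basis I))"

definition gapsvp_valid :: "gapsvp_instance \<Rightarrow> bool" where
  "gapsvp_valid I \<longleftrightarrow> basis I \<noteq> [] \<and> lattice_basis (dimension I) (real_basis I) \<and> 0 < threshold I"

definition GapSVP_inf :: "real \<Rightarrow> gapsvp_instance promise_problem" where
  "GapSVP_inf \<gamma> =
     ({I. gapsvp_valid I \<and> min_dist I \<le> of_rat (threshold I)},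
      {I. gapsvp_valid I \<and> min_dist I > \<gamma> * of_rat (threshold I)})"

definition enc_gapsvp :: "gapsvp_instance \<Rightarrow> nat list" where
  "enc_gapsvp I = enc_rat (threshold I) @ [5] @ concat (map enc_rat_vec (basis I))"

end

theory Submission
  imports Defs
begin

text \<open>
  The instance \<open>(s, [a\<^sub>1, \<dots>, a\<^sub>n])\<close> is mapped to the lattice of rank \<open>n + 1\<close> in dimension \<open>n + 2\<close>
  generated by \<open>b\<^sub>0 = (s, 1/2, 1/2, \<dots>, 1/2)\<close> and \<open>b\<^sub>i = (a\<^sub>i, 0, e\<^sub>i)\<close>, with threshold \<open>1/2\<close>. If \<open>x\<close> solves
  the subset sum instance, then \<open>- b\<^sub>0 + (\<Sum>i. x\<^sub>i * b\<^sub>i)\<close> has norm \<open>1/2\<close>. Conversely, let a nonzero lattice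
  vector of norm less than 1 have the coefficients \<open>z, x\<^sub>1, \<dots>, x\<^sub>n\<close>. The coordinate \<open>z/2\<close> forces
  \<open>z \<in> {-1, 0, 1}\<close>, the coordinates \<open>x\<^sub>i + z/2\<close> force \<open>x = 0\<close> if \<open>z = 0\<close> and \<open>- z * x\<^sub>i \<in> {0, 1}\<close> otherwise,
  and the integer coordinate \<open>s * z + (\<Sum>i. a\<^sub>i * x\<^sub>i)\<close> vanishes, so \<open>- z * x\<close> is a solution. Hence the
  minimum distance is at most \<open>1/2\<close> or at least 1, which is more than \<open>2 - \<epsilon>\<close> times the threshold.
\<close>

section \<open>The reduction\<close>

text \<open>The target is entry 0 of \<open>ns\<close>, so that all rows have the shape of a number
  followed by entries among 0, 1/2 and 1. A machine can then treat the target like a weight.\<close>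

definition ss_row :: "nat list \<Rightarrow> nat \<Rightarrow> rat vec" where
  "ss_row ns i = vec (Suc (length ns))
     (\<lambda>j. if j = 0 then of_nat (ns ! i) else if i = 0 then 1/2 else if j = Suc i then 1 else 0)"

definition ss_to_gapsvp :: "ss_instance \<Rightarrow> gapsvp_instance" where
  "ss_to_gapsvp = (\<lambda>(s, as).
     \<lparr>dimension = length as + 2,
      basis = map (ss_row (s # as)) [0..<Suc (length as)],
      threshold = 1/2\<rparr>)"

lemma lattice_rank_ss_to_gapsvp: "lattice_rank (ss_to_gapsvp (s, as)) = Suc (length as)"
  by (simp add: lattice_rank_def ss_to_gapsvp_def)

section \<open>Combinations of the rows and linear independence\<close>

definition real_row :: "nat list \<Rightarrow> nat \<Rightarrow> real vec" where
  "real_row ns i = vec (Suc (length ns))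
     (\<lambda>j. if j = 0 then real (ns ! i) else if i = 0 then 1/2 else if j = Suc i then 1 else 0)"

lemma real_basis_ss_to_gapsvp:
  "real_basis (ss_to_gapsvp (s, as)) = map (real_row (s # as)) [0..<Suc (length as)]"
proof -
  have "map_vec real_of_rat (ss_row ns i) = real_row ns i" for ns i
    by (rule eq_vecI) (auto simp: ss_row_def real_row_def of_rat_divide)
  then show ?thesis by (simp add: real_basis_def ss_to_gapsvp_def)
qed

lemma dim_real_row [simp]: "dim_vec (real_row ns i) = Suc (length ns)"
  by (simp add: real_row_def)

lemma real_row_index:
  "j \<le> length ns \<Longrightarrow> real_row ns i $ j =
     (if j = 0 then real (ns ! i) else if i = 0 then 1/2 else if j = Suc i then 1 else 0)"
  by (simp add: real_row_def)

lemma sum_real_row_index: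
  fixes c :: "nat \<Rightarrow> real"
  shows "(\<Sum>i<Suc (length as). c i * real_row (s # as) i $ 0) =
           c 0 * real s + (\<Sum>i<length as. c (Suc i) * real (as ! i))"
    and "(\<Sum>i<Suc (length as). c i * real_row (s # as) i $ 1) = c 0 / 2"
    and "j < length as \<Longrightarrow>
           (\<Sum>i<Suc (length as). c i * real_row (s # as) i $ (j + 2)) = c 0 / 2 + c (Suc j)"
proof -
  have split: "(\<Sum>i<Suc (length as). c i * real_row (s # as) i $ j) =
    c 0 * real_row (s # as) 0 $ j + (\<Sum>i<length as. c (Suc i) * real_row (s # as) (Suc i) $ j)" for j
    by (rule sum.lessThan_Suc_shift)
  show "(\<Sum>i<Suc (length as). c i * real_row (s # as) i $ 0) =
           c 0 * real s + (\<Sum>i<length as. c (Suc i) * real (as ! i))"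
    unfolding split by (simp add: real_row_index)
  show "(\<Sum>i<Suc (length as). c i * real_row (s # as) i $ 1) = c 0 / 2"
    unfolding split by (simp add: real_row_index)
  assume j: "j < length as"
  \<comment> \<open>Among the rows of the weights, only row \<open>Suc j\<close> is nonzero in
    coordinate \<open>j + 2\<close>.\<close>
  have "(\<Sum>i<length as. c (Suc i) * real_row (s # as) (Suc i) $ (j + 2)) =
      (\<Sum>i<length as. if i = j then c (Suc j) else 0)"
    using j by (intro sum.cong) (auto simp: real_row_index)
  then show "(\<Sum>i<Suc (length as). c i * real_row (s # as) i $ (j + 2)) = c 0 / 2 + c (Suc j)"
    unfolding split using j by (simp add: real_row_index sum.delta)
qed

text \<open>Coordinate \<open>Suc i\<close> separates row \<open>i\<close> from all others: 1
  against 1/2 or 0 if \<open>i > 0\<close>, and 1/2 against 0 if \<open>i = 0\<close>.\<close>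

lemma real_row_inj: "inj_on (real_row (s # as)) {..<Suc (length as)}"
proof (rule inj_onI)
  fix i i' assume *: "i \<in> {..<Suc (length as)}" "i' \<in> {..<Suc (length as)}"
    "real_row (s # as) i = real_row (s # as) i'"
  then have "real_row (s # as) i $ Suc i = real_row (s # as) i' $ Suc i"
      "real_row (s # as) i $ 1 = real_row (s # as) i' $ 1" by simp_all
  with *(1,2) show "i = i'"
    by (auto simp: real_row_index split: if_splits)
qed

text \<open>The system is triangular: coordinate 1 kills \<open>c 0\<close>, after which coordinate
  \<open>j + 2\<close> kills \<open>c (Suc j)\<close>.\<close>

lemma real_row_indep:
  fixes c :: "nat \<Rightarrow> real"
  assumes zero: "\<And>j. j < length as + 2 \<Longrightarrow>
      (\<Sum>i<Suc (length as). c i * real_row (s # as) i $ j) = 0"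
    and i: "i < Suc (length as)"
  shows "c i = 0"
proof -
  have "c 0 / 2 = 0"
    using zero[of 1] unfolding sum_real_row_index by simp
  moreover have "c 0 / 2 + c i = 0" if "i \<noteq> 0"
  proof -
    from that i obtain j where j: "i = Suc j" "j < length as" by (cases i) auto
    show ?thesis
      using zero[of "j + 2"] j(2) unfolding sum_real_row_index(3)[OF j(2)] j(1) by simp
  qed
  ultimately show ?thesis by (cases "i = 0") auto
qed

lemma lattice_basis_ss_to_gapsvp:
  "lattice_basis (length as + 2) (real_basis (ss_to_gapsvp (s, as)))"
proof -
  let ?m = "length as + 2" and ?k = "Suc (length as)"
  define b where "b = real_row (s # as)"
  define S where "S = b ` {..<?k}"
  have carr: "S \<subseteq> carrier_vec ?m" by (auto simp: S_def b_def intro!: carrier_vecI)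
  have inj: "inj_on b {..<?k}" unfolding b_def by (rule real_row_inj)
  have finite_S: "finite S" by (simp add: S_def)
  interpret vec_space "TYPE(real)" ?m .
  have "lin_indpt S"
  proof (rule finite_lin_indpt2[OF finite_S carr])
    fix a assume lc: "lincomb a S = 0\<^sub>v ?m"
    have "(\<Sum>i<?k. a (b i) * b i $ j) = 0" if "j < ?m" for j
    proof -
      have "(\<Sum>i<?k. a (b i) * b i $ j) = (\<Sum>x\<in>S. a x * x $ j)"
        by (simp only: S_def sum.reindex[OF inj] o_def)
      also have "\<dots> = lincomb a S $ j" by (rule lincomb_index[OF that carr, symmetric])
      also have "\<dots> = 0" unfolding lc by (rule index_zero_vec(1)[OF that])
      finally show ?thesis .
    qed
    then have "a (b i) = 0" if "i < ?k" for i
      unfolding b_def using that by (rule real_row_indep)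
    then show "\<forall>v\<in>S. a v = 0" unfolding S_def by blast
  qed
  moreover have "real_basis (ss_to_gapsvp (s, as)) = map b [0..<?k]"
    by (simp only: real_basis_ss_to_gapsvp b_def)
  moreover have "set (map b [0..<?k]) = S" by (simp only: S_def set_map set_upt lessThan_atLeast0)
  moreover have "distinct (map b [0..<?k])"
    using inj by (simp only: distinct_map distinct_upt set_upt lessThan_atLeast0 simp_thms)
  ultimately show ?thesis
    using carr by (simp only: lattice_basis_def simp_thms)
qed

section \<open>Lattice vectors by their integer coefficients\<close>

lemma lattice_of_map_eq:
  fixes b :: "nat \<Rightarrow> real vec"
  assumes "\<And>i. i < k \<Longrightarrow> b i \<in> carrier_vec m"
  shows "vec_module.lattice_of m (map b [0..<k]) =
    range (\<lambda>c :: nat \<Rightarrow> int. vec m (\<lambda>j. \<Sum>i<k. of_int (c i) * b i $ j))"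
proof -
  interpret vec_module "TYPE(real)" m .
  have "sumlist (map (\<lambda>i. of_int (c i) \<cdot>\<^sub>v map b [0..<k] ! i) [0..<length (map b [0..<k])]) =
      vec m (\<lambda>j. \<Sum>i<k. of_int (c i) * b i $ j)" (is "sumlist ?bs = _") for c :: "nat \<Rightarrow> int"
  proof (rule eq_vecI)
    have carr: "\<forall>x\<in>set ?bs. dim_vec x = m"
      using assms by auto
    then show "dim_vec (sumlist ?bs) = dim_vec (vec m (\<lambda>j. \<Sum>i<k. of_int (c i) * b i $ j))"
      by (simp add: dim_sumlist)
    fix j assume "j < dim_vec (vec m (\<lambda>j. \<Sum>i<k. of_int (c i) * b i $ j))"
    then have j: "j < m" by simp
    have "sumlist ?bs $ j = (\<Sum>i = 0..<k. ?bs ! i $ j)"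
      using sumlist_nth[OF carr j] by simp
    also have "\<dots> = (\<Sum>i<k. of_int (c i) * b i $ j)"
      unfolding lessThan_atLeast0 using j carrier_vecD[OF assms] by (intro sum.cong) auto
    finally show "sumlist ?bs $ j = vec m (\<lambda>j. \<Sum>i<k. of_int (c i) * b i $ j) $ j"
      using j by simp
  qed
  then show ?thesis unfolding lattice_of_def by (simp only:)
qed

lemma ss_lattice_eq:
  "vec_module.lattice_of (length as + 2) (real_basis (ss_to_gapsvp (s, as))) =
     range (\<lambda>c :: nat \<Rightarrow> int. vec (length as + 2)
       (\<lambda>j. \<Sum>i<Suc (length as). of_int (c i) * real_row (s # as) i $ j))"
  unfolding real_basis_ss_to_gapsvp
  by (rule lattice_of_map_eq) (rule carrier_vecI, simp)

lemma ss_lattice_vector: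
  fixes c :: "nat \<Rightarrow> int" and as :: "nat list" and s :: nat
  defines "v \<equiv> vec (length as + 2)
       (\<lambda>j. \<Sum>i<Suc (length as). real_of_int (c i) * real_row (s # as) i $ j)"
  shows "v $ 0 = of_int (c 0 * int s + (\<Sum>i<length as. c (Suc i) * int (as ! i)))"
    and "v $ 1 = of_int (c 0) / 2"
    and "i < length as \<Longrightarrow> v $ (i + 2) = of_int (c 0) / 2 + of_int (c (Suc i))"
  using sum_real_row_index[where c = "\<lambda>i. real_of_int (c i)" and s = s and as = as]
  by (simp_all add: v_def del: sum.lessThan_Suc)

lemma coordinate_cases:
  fixes j n :: nat
  assumes "j < n + 2"
  obtains "j = 0" | "j = 1" | i where "i < n" "j = i + 2"
proof -
  have "j = 0 \<or> j = 1 \<or> (\<exists>i<n. j = i + 2)" using assms by presburger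
  then show thesis using that by blast
qed

section \<open>From short vectors to subset sums\<close>

lemma linf_norm_ge: "i < dim_vec v \<Longrightarrow> \<bar>v $ i\<bar> \<le> linf_norm v"
  unfolding linf_norm_def by (rule Max_ge) auto

lemma linf_norm_le: "0 < dim_vec v \<Longrightarrow> (\<And>i. i < dim_vec v \<Longrightarrow> \<bar>v $ i\<bar> \<le> r) \<Longrightarrow> linf_norm v \<le> r"
  unfolding linf_norm_def by (subst Max_le_iff) auto

text \<open>Doubling gives an integer of absolute value below 2. For \<open>z = 0\<close> it is
  even, hence 0; otherwise it is odd, hence 1 or -1, which leaves \<open>x = 0\<close> or
  \<open>x = - z\<close>.\<close>

lemma small_half_integer_sum:
  assumes "\<bar>of_int z / 2 + of_int x :: real\<bar> < 1" "\<bar>z\<bar> \<le> 1"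
  shows "if z = 0 then x = 0 else - z * x \<in> {0, 1}"
proof -
  have "\<bar>of_int (z + 2 * x) :: real\<bar> < of_int 2"
    using assms(1) by simp
  then have "\<bar>z + 2 * x\<bar> < 2"
    by (simp only: of_int_abs[symmetric] of_int_less_iff)
  moreover have "z \<in> {-1, 0, 1}" using assms(2) by auto
  ultimately show ?thesis by auto
qed

lemma ss_lattice_short_vector:
  assumes v: "v \<in> vec_module.lattice_of (length as + 2) (real_basis (ss_to_gapsvp (s, as)))"
    and nz: "v \<noteq> 0\<^sub>v (length as + 2)" and short: "linf_norm v < 1"
  shows "has_subset_sum (s, as)"
proof -
  let ?n = "length as"
  from v obtain c :: "nat \<Rightarrow> int" where v_eq: "v = vec (?n + 2)
       (\<lambda>j. \<Sum>i<Suc ?n. real_of_int (c i) * real_row (s # as) i $ j)"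
    unfolding ss_lattice_eq by auto
  note idx = ss_lattice_vector[where c = c and as = as and s = s, folded v_eq]
  have dim: "dim_vec v = ?n + 2" by (simp add: v_eq)
  have small: "\<bar>v $ j\<bar> < 1" if "j < ?n + 2" for j
    using linf_norm_ge[of j v] that dim short by linarith
  define T where "T = c 0 * int s + (\<Sum>i<?n. c (Suc i) * int (as ! i))"
  have "\<bar>real_of_int T\<bar> < 1" using small[of 0] idx(1) by (simp add: T_def)
  then have T: "T = 0" by linarith
  have z: "\<bar>c 0\<bar> \<le> 1" using small[of 1] idx(2) by auto
  have x: "if c 0 = 0 then c (Suc i) = 0 else - c 0 * c (Suc i) \<in> {0, 1}" if "i < ?n" for i
    using small[of "i + 2"] idx(3)[OF that] that z by (intro small_half_integer_sum) auto
  have "c 0 \<noteq> 0"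
  proof
    assume z0: "c 0 = 0"
    have "v = 0\<^sub>v (?n + 2)"
    proof (rule eq_vecI)
      fix j assume "j < dim_vec (0\<^sub>v (?n + 2) :: real vec)"
      then have "j < ?n + 2" by simp
      then consider "j = 0" | "j = 1" | i where "i < ?n" "j = i + 2"
        by (rule coordinate_cases)
      then show "v $ j = 0\<^sub>v (?n + 2) $ j"
        using idx T x z0 by cases (auto simp: T_def)
    qed (simp add: dim)
    with nz show False ..
  qed
  then have z1: "c 0 * c 0 = 1" using z by (cases "c 0 = 1"; cases "c 0 = -1") auto
  \<comment> \<open>The sign \<open>- c 0\<close> normalises the vector: multiplied by it, the
    coefficient of the target becomes -1 and those of the weights become 0 or 1.\<close>
  define y where "y i = nat (- c 0 * c (Suc i))" for i
  have y: "int (y i) = - c 0 * c (Suc i)" "y i \<in> {0, 1}" if "i < ?n" for i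
    using x[OF that] \<open>c 0 \<noteq> 0\<close> by (auto simp: y_def)
  have "int (\<Sum>i<?n. as ! i * y i) = (\<Sum>i<?n. - c 0 * (c (Suc i) * int (as ! i)))"
    unfolding of_nat_sum by (intro sum.cong) (auto simp: y)
  also have "\<dots> = - c 0 * (\<Sum>i<?n. c (Suc i) * int (as ! i))"
    by (simp only: sum_distrib_left)
  also have "\<dots> = - c 0 * (T - c 0 * int s)" by (simp add: T_def)
  also have "\<dots> = int s" using z1 by (simp add: T flip: mult.assoc)
  finally have "(\<Sum>i<?n. as ! i * y i) = s" by linarith
  with y show ?thesis by (auto simp: has_subset_sum_def)
qed

section \<open>The minimum distance in the two cases\<close>

lemma min_dist_no:
  assumes "\<not> has_subset_sum (s, as)"
  shows "1 \<le> min_dist (ss_to_gapsvp (s, as))"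
proof -
  let ?n = "length as"
  let ?L = "vec_module.lattice_of (?n + 2) (real_basis (ss_to_gapsvp (s, as)))"
  \<comment> \<open>Row 0 alone is a nonzero lattice vector. Such a witness is needed because a
    lower bound passes to the infimum of a nonempty set only.\<close>
  define c :: "nat \<Rightarrow> int" where "c i = (if i = 0 then 1 else 0)" for i
  define v where "v = vec (?n + 2) (\<lambda>j. \<Sum>i<Suc ?n. real_of_int (c i) * real_row (s # as) i $ j)"
  have "v $ 1 = 1 / 2"
    using ss_lattice_vector(2)[where c = c and as = as and s = s] by (simp add: v_def c_def)
  then have "v \<noteq> 0\<^sub>v (?n + 2)" by auto
  moreover have "v \<in> ?L" unfolding ss_lattice_eq v_def by blast
  ultimately have "?L - {0\<^sub>v (?n + 2)} \<noteq> {}" by blast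
  moreover have dim: "dimension (ss_to_gapsvp (s, as)) = ?n + 2" by (simp add: ss_to_gapsvp_def)
  ultimately show ?thesis
    unfolding min_dist_def lambda1_inf_def
  proof (intro cInf_greatest)
    fix r assume "r \<in> linf_norm ` (vec_module.lattice_of (dimension (ss_to_gapsvp (s, as)))
        (real_basis (ss_to_gapsvp (s, as))) - {0\<^sub>v (dimension (ss_to_gapsvp (s, as)))})"
    then obtain w where "w \<in> ?L" "w \<noteq> 0\<^sub>v (?n + 2)" "r = linf_norm w"
      unfolding dim by blast
    then show "1 \<le> r"
      using ss_lattice_short_vector[of w as s] assms by (meson not_le)
  qed (simp only: dim image_is_empty not_False_eq_True)
qed

lemma min_dist_yes:
  assumes "has_subset_sum (s, as)"
  shows "min_dist (ss_to_gapsvp (s, as)) \<le> 1 / 2"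
proof -
  let ?n = "length as"
  let ?L = "vec_module.lattice_of (?n + 2) (real_basis (ss_to_gapsvp (s, as)))"
  from assms obtain x :: "nat \<Rightarrow> nat" where x: "\<And>i. i < ?n \<Longrightarrow> x i \<in> {0, 1}"
      "(\<Sum>i<?n. as ! i * x i) = s"
    by (auto simp: has_subset_sum_def)
  \<comment> \<open>Coefficient -1 for the target turns coordinate 0 into the sum minus
    \<open>s\<close> and coordinate \<open>i + 2\<close> into \<open>x i - 1/2\<close>.\<close>
  define c :: "nat \<Rightarrow> int" where "c i = (if i = 0 then -1 else int (x (i - 1)))" for i
  define v where "v = vec (?n + 2) (\<lambda>j. \<Sum>i<Suc ?n. real_of_int (c i) * real_row (s # as) i $ j)"
  note idx = ss_lattice_vector[where c = c and as = as and s = s, folded v_def]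
  have "v $ 1 = - 1 / 2" using idx(2) by (simp add: c_def)
  then have nz: "v \<noteq> 0\<^sub>v (?n + 2)" by auto
  have "v \<in> ?L" unfolding ss_lattice_eq v_def by blast
  have "(\<Sum>i<?n. int (x i) * int (as ! i)) = int s"
    unfolding x(2)[symmetric] by (simp add: mult.commute)
  then have "v $ 0 = 0" using idx(1) by (simp add: c_def)
  have le: "linf_norm v \<le> 1 / 2"
  proof (rule linf_norm_le)
    fix j assume "j < dim_vec v"
    then have "j < ?n + 2" by (simp add: v_def)
    then consider "j = 0" | "j = 1" | i where "i < ?n" "j = i + 2"
      by (rule coordinate_cases)
    then show "\<bar>v $ j\<bar> \<le> 1 / 2"
    proof cases
      case (3 i)
      then show ?thesis using idx(3)[of i] x(1)[of i] by (auto simp: c_def)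
    qed (use \<open>v $ 0 = 0\<close> \<open>v $ 1 = - 1 / 2\<close> in simp_all)
  qed (simp add: v_def)
  \<comment> \<open>The infimum lies below its members once the set is known to be bounded
    below.\<close>
  have "linf_norm w \<ge> 0" if "w \<in> ?L" for w
  proof -
    have "0 < dim_vec w" using that unfolding ss_lattice_eq by auto
    then show ?thesis using linf_norm_ge[of 0 w] abs_ge_zero[of "w $ 0"] by linarith
  qed
  then have "bdd_below (linf_norm ` (?L - {0\<^sub>v (?n + 2)}))"
    by (intro bdd_belowI[of _ 0]) auto
  then have "Inf (linf_norm ` (?L - {0\<^sub>v (?n + 2)})) \<le> linf_norm v"
    using \<open>v \<in> ?L\<close> nz by (intro cInf_lower) auto
  with le show ?thesis
    by (simp add: min_dist_def lambda1_inf_def ss_to_gapsvp_def)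
qed

lemma gapsvp_valid_ss_to_gapsvp: "gapsvp_valid (ss_to_gapsvp (s, as))"
  using lattice_basis_ss_to_gapsvp[of as s]
  by (simp add: gapsvp_valid_def ss_to_gapsvp_def)

lemma ss_to_gapsvp_correct:
  assumes "0 < \<epsilon>"
  shows "x \<in> fst SS \<Longrightarrow> ss_to_gapsvp x \<in> fst (GapSVP_inf (2 - \<epsilon>))"
    and "x \<in> snd SS \<Longrightarrow> ss_to_gapsvp x \<in> snd (GapSVP_inf (2 - \<epsilon>))"
proof -
  obtain s as where x: "x = (s, as)" by (cases x)
  have th: "of_rat (threshold (ss_to_gapsvp x)) = (1 / 2 :: real)"
    by (simp add: x ss_to_gapsvp_def of_rat_divide)
  show "x \<in> fst SS \<Longrightarrow> ss_to_gapsvp x \<in> fst (GapSVP_inf (2 - \<epsilon>))"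
    using min_dist_yes[of s as] gapsvp_valid_ss_to_gapsvp[of s as] th
    by (auto simp: SS_def GapSVP_inf_def x)
  \<comment> \<open>The product is \<open>1 - \<epsilon> / 2\<close>, strictly below the bound 1 of
    \<open>min_dist_no\<close>.\<close>
  have "(2 - \<epsilon>) * of_rat (threshold (ss_to_gapsvp x)) < 1" unfolding th using assms by simp
  then show "x \<in> snd SS \<Longrightarrow> ss_to_gapsvp x \<in> snd (GapSVP_inf (2 - \<epsilon>))"
    using min_dist_no[of s as] gapsvp_valid_ss_to_gapsvp[of s as]
    by (auto simp: SS_def GapSVP_inf_def x)
qed

section \<open>The Turing machine\<close>

text \<open>
  State 0 counts the numbers of the input in unary on tape 3 and puts a mark on tape 2; state 1 rewinds
  the input; state 2 copies a number; state 3 sweeps over the cells of tape 3, one matrix entry per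
  cell; state 4 returns to the left end of tape 3; states 5 to 16 write constant words. On tape 3 the
  symbol 2 stands for row 0, and the first return overwrites it by 1. The head of tape 2 moves along
  with that of tape 3 in both directions except for the last step of a return, so that it starts each
  row one cell further to the left and meets the mark in column \<open>i\<close> of row \<open>i\<close>.
\<close>

definition red_trans :: "nat \<Rightarrow> nat list \<Rightarrow> nat \<times> (nat \<times> movement) list" where
  "red_trans q rs = (let a = rs ! 0; b = rs ! 1; c = rs ! 2; d = rs ! 3;
     emit = (\<lambda>q' x. (q', [(a, Stay), (x, Right), (c, Stay), (d, Stay)])) in
     if q = 0 then
       (if a = 0 then (1, [(a, Left), (b, Stay), (1, Stay), (d, Right)])
        else if a = 5 then (0, [(a, Right), (b, Stay), (c, Stay), (2, Left)])
        else (0, [(a, Right), (b, Stay), (c, Stay), (d, Stay)]))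
     else if q = 1 then
       (if a = 0 then (5, [(a, Right), (b, Stay), (c, Stay), (d, Stay)])
        else (1, [(a, Left), (b, Stay), (c, Stay), (d, Stay)]))
     else if q = 2 then
       (if a = 0 then (17, [(a, Stay), (b, Stay), (c, Stay), (d, Stay)])
        else if a = 5 then (16, [(a, Right), (b, Stay), (c, Stay), (d, Stay)])
        else (2, [(a, Right), (a, Right), (c, Stay), (d, Stay)]))
     else if q = 3 then
       (if d = 0 then (4, [(a, Stay), (6, Right), (c, Left), (d, Left)])
        else (if d = 2 then 10 else if c = 1 then 15 else 16,
              [(a, Stay), (b, Stay), (c, Right), (d, Right)]))
     else if q = 4 then
       (if d = 0 then (2, [(a, Stay), (b, Stay), (c, Stay), (d, Right)])
        else (4, [(a, Stay), (b, Stay), (c, Left), (1, Left)]))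
     else if q = 5 then emit 6 2
     else if q = 6 then emit 7 4
     else if q = 7 then emit 8 1
     else if q = 8 then emit 9 2
     else if q = 9 then emit 2 5
     else if q = 10 then emit 11 2
     else if q = 11 then emit 12 4
     else if q = 12 then emit 13 1
     else if q = 13 then emit 14 2
     else if q = 14 then emit 3 5
     else if q = 15 then emit 16 2
     else emit 13 4)"

definition red_tm :: turing_machine where
  "red_tm = \<lparr>tm_tapes = 4, tm_symbols = 7, tm_states = 17, tm_trans = red_trans\<rparr>"

lemma tm_wf_red_tm: "tm_wf red_tm"
proof -
  have "q' \<le> 17 \<and> length as = 4 \<and> fst ` set as \<subseteq> {..<7}"
    if "length rs = 4" "set rs \<subseteq> {..<7}" "red_trans q rs = (q', as)" for q rs q' as
  proof -
    from that(1) have "length rs = Suc (Suc (Suc (Suc 0)))" by simp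
    then obtain a b c d where rs: "rs = [a, b, c, d]"
      by (auto simp: length_Suc_conv)
    show ?thesis
      using that(2,3) unfolding rs red_trans_def Let_def
      by (auto simp: numeral_eq_Suc split: if_splits)
  qed
  then show ?thesis by (auto simp: tm_wf_def red_tm_def)
qed

section \<open>Runs with time bounds\<close>

definition reaches :: "nat \<Rightarrow> config \<Rightarrow> config \<Rightarrow> bool" where
  "reaches t C C' \<longleftrightarrow> (\<exists>t'\<le>t. (tm_step red_tm ^^ t') C = C')"

lemma reaches_funpow: "(tm_step red_tm ^^ t) C = C' \<Longrightarrow> reaches t C C'"
  by (auto simp: reaches_def)

lemma reaches_refl: "reaches t C C"
  unfolding reaches_def by (intro exI[of _ 0]) simp

lemma reaches_trans [trans]:
  assumes "reaches s C C'" "reaches t C' C''"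
  shows "reaches (s + t) C C''"
proof -
  from assms obtain s' t' where "s' \<le> s" "t' \<le> t"
      "(tm_step red_tm ^^ s') C = C'" "(tm_step red_tm ^^ t') C' = C''"
    by (auto simp: reaches_def)
  then have "t' + s' \<le> s + t \<and> (tm_step red_tm ^^ (t' + s')) C = C''"
    by (simp add: funpow_add)
  then show ?thesis unfolding reaches_def by blast
qed

lemma reaches_mono: "reaches s C C' \<Longrightarrow> s \<le> t \<Longrightarrow> reaches t C C'"
  by (auto simp: reaches_def intro: order_trans)

text \<open>For symbolic execution: the simplifier evaluates one transition, and the run continues
  from its result.\<close>

lemma reaches_step:
  assumes "reaches t (tm_step red_tm C) C'"
  shows "reaches (Suc t) C C'"
proof -
  from assms obtain t' where "t' \<le> t" "(tm_step red_tm ^^ t') (tm_step red_tm C) = C'"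
    by (auto simp: reaches_def)
  then have "Suc t' \<le> Suc t \<and> (tm_step red_tm ^^ Suc t') C = C'"
    by (simp add: funpow_swap1)
  then show ?thesis unfolding reaches_def by blast
qed

lemma funpow_tm_step_halted:
  "(tm_step red_tm ^^ t) (tm_states red_tm, ts) = (tm_states red_tm, ts)"
  by (induction t) (simp_all add: tm_step_def)

text \<open>\<open>reaches\<close> only bounds the number of steps, so that bounds can be added and
  relaxed; a halted configuration is fixed, so idle steps fill up the rest.\<close>

lemma reaches_halted_exact:
  assumes "reaches t C (17, ts)"
  shows "(tm_step red_tm ^^ t) C = (17, ts)"
proof -
  from assms obtain t' where t': "t' \<le> t" "(tm_step red_tm ^^ t') C = (17, ts)"
    by (auto simp: reaches_def)
  then have "(tm_step red_tm ^^ (t - t' + t')) C = (17, ts)"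
    using funpow_tm_step_halted[of "t - t'" ts]
    unfolding funpow_add by (simp add: red_tm_def)
  with t' show ?thesis by simp
qed

definition out_tape :: "nat list \<Rightarrow> tape" where
  "out_tape v = (word_content v, int (length v))"

lemma tape_action_out_tape [simp]: "tape_action (x, Right) (out_tape v) = out_tape (v @ [x])"
  by (auto simp: out_tape_def word_content_def nth_append fun_eq_iff)

lemma tape_action_stay [simp]: "tape_action (head_symbol t, Stay) t = t"
  by (cases t) simp

text \<open>\<open>u\<close> is the part already read and \<open>z\<close> the part still to be read
  from the head onwards.\<close>

definition in_tape :: "nat list \<Rightarrow> nat list \<Rightarrow> tape" where
  "in_tape u z = (word_content (u @ z), int (length u))"

lemma head_symbol_in_tape [simp]:
  "head_symbol (in_tape u []) = 0" "head_symbol (in_tape u (x # z)) = x"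
  by (simp_all add: in_tape_def word_content_def)

lemma tape_action_in_tape_right [simp]:
  "tape_action (x, Right) (in_tape u (x # z)) = in_tape (u @ [x]) z"
  by (auto simp: in_tape_def word_content_def fun_eq_iff nth_append)

lemmas red_step_simps = tm_step_def red_tm_def red_trans_def Let_def

text \<open>The words are 1/2, 1 and 0 with the terminator 5. As 0 has the empty numerator, the last
  word also completes a copied number by the denominator 1. The words begun in states 10, 15 and 16
  share the states 13 and 14.\<close>

lemma reaches_emit:
  shows "reaches 5 (5, [t0, out_tape v, t2, t3]) (2, [t0, out_tape (v @ [2,4,1,2,5]), t2, t3])"
    and "reaches 5 (10, [t0, out_tape v, t2, t3]) (3, [t0, out_tape (v @ [2,4,1,2,5]), t2, t3])"
    and "reaches 4 (15, [t0, out_tape v, t2, t3]) (3, [t0, out_tape (v @ [2,4,2,5]), t2, t3])"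
    and "reaches 3 (16, [t0, out_tape v, t2, t3]) (3, [t0, out_tape (v @ [4,2,5]), t2, t3])"
proof -
  show "reaches 5 (5, [t0, out_tape v, t2, t3]) (2, [t0, out_tape (v @ [2,4,1,2,5]), t2, t3])"
    by (rule reaches_mono[of "Suc (Suc (Suc (Suc (Suc 0))))"], (rule reaches_step)+)
      (simp_all add: red_step_simps reaches_refl)
  show "reaches 5 (10, [t0, out_tape v, t2, t3]) (3, [t0, out_tape (v @ [2,4,1,2,5]), t2, t3])"
    by (rule reaches_mono[of "Suc (Suc (Suc (Suc (Suc 0))))"], (rule reaches_step)+)
      (simp_all add: red_step_simps reaches_refl)
  show "reaches 4 (15, [t0, out_tape v, t2, t3]) (3, [t0, out_tape (v @ [2,4,2,5]), t2, t3])"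
    by (rule reaches_mono[of "Suc (Suc (Suc (Suc 0)))"], (rule reaches_step)+)
      (simp_all add: red_step_simps reaches_refl)
  show "reaches 3 (16, [t0, out_tape v, t2, t3]) (3, [t0, out_tape (v @ [4,2,5]), t2, t3])"
    by (rule reaches_mono[of "Suc (Suc (Suc 0))"], (rule reaches_step)+)
      (simp_all add: red_step_simps reaches_refl)
qed

section \<open>The phases of the machine\<close>

definition blk :: "nat \<Rightarrow> nat \<Rightarrow> int \<Rightarrow> nat" where
  "blk k x = (\<lambda>p. if - int k < p \<and> p \<le> 0 then x else 0)"

text \<open>Every terminator 5 adds a cell at the left of the block, so the block counts the numbers
  read; the head waits on the cell to be filled next.\<close>

lemma reaches_count:
  assumes "0 \<notin> set z"
  shows "reaches (length z) (0, [in_tape u z, t1, t2, (blk j 2, - int j)])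
    (0, [in_tape (u @ z) [], t1, t2, (blk (j + count_list z 5) 2, - int (j + count_list z 5))])"
  using assms
proof (induction z arbitrary: u j)
  case (Cons x z)
  have *: "(blk j 2)(- int j := 2) = blk (Suc j) 2"
    by (auto simp: blk_def fun_eq_iff)
  define j' where "j' = (if x = 5 then Suc j else j)"
  have "tm_step red_tm (0, [in_tape u (x # z), t1, t2, (blk j 2, - int j)]) =
      (0, [in_tape (u @ [x]) z, t1, t2, (blk j' 2, - int j')])"
    using Cons.prems * by (auto simp: red_step_simps j'_def)
  moreover have "j' + count_list z 5 = j + count_list (x # z) 5"
    by (simp add: j'_def)
  ultimately show ?case
    using Cons.prems Cons.IH[of "u @ [x]" j'] by (auto intro: reaches_step)
qed (simp add: reaches_refl)

text \<open>The \<open>m\<close> nonblank cells from the head leftwards are passed one by one; the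
  last step turns around at the blank in position -1.\<close>

lemma reaches_rewind:
  assumes "0 \<notin> set w" "m \<le> length w"
  shows "reaches (Suc m) (1, [(word_content w, int m - 1), t1, t2, t3]) (5, [in_tape [] w, t1, t2, t3])"
  using assms(2)
proof (induction m)
  case 0
  have "(word_content w)(- 1 := 0) = word_content w" "word_content w (- 1) = 0"
    by (auto simp: word_content_def fun_eq_iff)
  then show ?case
    by (auto intro!: reaches_step reaches_refl simp: red_step_simps in_tape_def)
next
  case (Suc m)
  then have "word_content w (int m) \<noteq> 0"
    using assms(1) by (auto simp: word_content_def in_set_conv_nth)
  with Suc show ?case
    by (auto intro!: reaches_step[of "Suc m"] simp: red_step_simps)
qed

text \<open>Digits are neither blank nor terminator, so copying goes on until the 5; the last step
  skips it and leaves the denominator to state 16.\<close>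

lemma reaches_copy:
  assumes "set d \<subseteq> {1, 2}"
  shows "reaches (length d + 1) (2, [in_tape u (d @ 5 # z), out_tape v, t2, t3])
    (16, [in_tape (u @ d @ [5]) z, out_tape (v @ d), t2, t3])"
  using assms
proof (induction d arbitrary: u v)
  case Nil
  then show ?case by (auto intro!: reaches_step reaches_refl simp: red_step_simps)
next
  case (Cons x d)
  then show ?case
    using Cons.IH[of "u @ [x]" "v @ [x]"]
    by (auto intro!: reaches_step[of "Suc (length d)"] simp: red_step_simps)
qed

definition marker :: "int \<Rightarrow> nat" where
  "marker p = (if p = 0 then 1 else 0)"

text \<open>Entry \<open>j\<close> is coordinate \<open>Suc j\<close> of row \<open>i\<close>, so
  the 1 stands at \<open>j = i\<close> and not at \<open>j = Suc i\<close> as in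
  \<open>ss_row\<close>.\<close>

definition enc_entry :: "nat \<Rightarrow> nat \<Rightarrow> nat list" where
  "enc_entry i j = (if i = 0 then [2,4,1,2,5] else if j = i then [2,4,2,5] else [4,2,5])"

text \<open>\<open>r\<close> entries remain. The head of tape 2 is at \<open>j - i\<close> and meets
  the mark exactly for \<open>j = i\<close>; the symbol 2 on tape 3 identifies row 0. An entry takes
  one step to choose the word and at most five to write it.\<close>

lemma reaches_entries:
  assumes "j + r = k" "x = (if i = 0 then 2 else 1)"
  shows "reaches (6 * r)
    (3, [t0, out_tape v, (marker, int j - int i), (blk k x, 1 - int k + int j)])
    (3, [t0, out_tape (v @ concat (map (enc_entry i) [j..<k])), (marker, int k - int i), (blk k x, 1)])"
  using assms(1)
proof (induction r arbitrary: j v)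
  case 0
  then show ?case by (simp add: reaches_refl)
next
  case (Suc r)
  let ?t2 = "(marker, int (Suc j) - int i)" and ?t3 = "(blk k x, 1 - int k + int (Suc j))"
  have "blk k x (1 - int k + int j) = x"
    using Suc.prems by (auto simp: blk_def)
  then have "tm_step red_tm (3, [t0, out_tape v, (marker, int j - int i), (blk k x, 1 - int k + int j)])
      = (if i = 0 then 10 else if j = i then 15 else 16, [t0, out_tape v, ?t2, ?t3])"
    using assms(2) by (cases "i = 0"; cases "j = i") (simp_all add: red_step_simps marker_def fun_upd_idem)
  moreover have "reaches 5 (if i = 0 then 10 else if j = i then 15 else 16, [t0, out_tape v, ?t2, ?t3])
      (3, [t0, out_tape (v @ enc_entry i j), ?t2, ?t3])"
    using reaches_emit(2)[of t0 v ?t2 ?t3] reaches_mono[OF reaches_emit(3)[of t0 v ?t2 ?t3], of 5]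
      reaches_mono[OF reaches_emit(4)[of t0 v ?t2 ?t3], of 5] by (auto simp: enc_entry_def)
  ultimately have "reaches (Suc 5)
      (3, [t0, out_tape v, (marker, int j - int i), (blk k x, 1 - int k + int j)])
      (3, [t0, out_tape (v @ enc_entry i j), ?t2, ?t3])"
    by (intro reaches_step) simp
  also have "reaches (6 * r) (3, [t0, out_tape (v @ enc_entry i j), ?t2, ?t3])
    (3, [t0, out_tape ((v @ enc_entry i j) @ concat (map (enc_entry i) [Suc j..<k])),
         (marker, int k - int i), (blk k x, 1)])"
    using Suc by (intro Suc.IH) simp
  finally show ?case
    using Suc.prems by (simp add: upt_conv_Cons)
qed

text \<open>Midway, \<open>j\<close> cells have been overwritten by 1 and \<open>r\<close> still
  hold \<open>x\<close>. The final step, at the blank, moves the head of tape 3 only, so that of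
  tape 2 goes back by \<open>r\<close> and not by \<open>Suc r\<close>.\<close>

lemma reaches_return:
  assumes "x \<noteq> 0" "j + r = k"
  shows "reaches (Suc r)
    (4, [t0, t1, (m, p), (\<lambda>p. if - int j < p then blk k 1 p else blk k x p, - int j)])
    (2, [t0, t1, (m, p - int r), (blk k 1, 1 - int k)])"
  using assms(2)
proof (induction r arbitrary: j p)
  case 0
  then have "(\<lambda>p. if - int j < p then blk k 1 p else blk k x p) = blk k 1"
    by (auto simp: blk_def fun_eq_iff)
  moreover have "blk k 1 (- int j) = 0" "(blk k 1)(- int j := 0) = blk k 1"
    using 0 by (auto simp: blk_def fun_eq_iff)
  ultimately show ?case
    using 0 by (auto intro!: reaches_step reaches_refl simp: red_step_simps)
next
  case (Suc r)
  have "blk k x (- int j) = x"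
    using Suc.prems by (auto simp: blk_def)
  moreover have "(\<lambda>p. if - int j < p then blk k 1 p else blk k x p)(- int j := 1) =
      (\<lambda>p. if - int (Suc j) < p then blk k 1 p else blk k x p)"
    using Suc.prems by (auto simp: blk_def fun_eq_iff)
  ultimately have "tm_step red_tm
      (4, [t0, t1, (m, p), (\<lambda>p. if - int j < p then blk k 1 p else blk k x p, - int j)]) =
      (4, [t0, t1, (m, p - 1),
        (\<lambda>p. if - int (Suc j) < p then blk k 1 p else blk k x p, - int (Suc j))])"
    using assms(1) by (simp add: red_step_simps)
  then show ?case
    using Suc.prems Suc.IH[of "Suc j" "p - 1"] by (intro reaches_step[of "Suc r"]) (simp add: diff_diff_eq)
qed

section \<open>Writing the rows and the complete run\<close>

definition enc_ss_row :: "nat \<Rightarrow> nat \<Rightarrow> nat \<Rightarrow> nat list" where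
  "enc_ss_row k i a = enc_nat a @ [4,2,5] @ concat (map (enc_entry i) [0..<k]) @ [6]"

lemma set_enc_nat: "set (enc_nat n) \<subseteq> {1, 2}"
proof (induction n rule: enc_nat.induct)
  case (1 n)
  then show ?case by (subst enc_nat.simps) auto
qed

text \<open>The head of tape 2 moves right \<open>k\<close> times, left once at the turn and left
  \<open>k\<close> times on the return: a net shift by -1. Besides copying, the steps are 3 for the
  denominator, \<open>6 * k\<close> for the entries, 1 for the turn and \<open>k + 1\<close> for the
  return.\<close>

lemma reaches_row:
  assumes "x = (if i = 0 then 2 else 1)"
  shows "reaches (length (enc_nat a) + 7 * k + 6)
    (2, [in_tape u (enc_nat a @ 5 # z), out_tape v, (marker, - int i), (blk k x, 1 - int k)])
    (2, [in_tape (u @ enc_nat a @ [5]) z, out_tape (v @ enc_ss_row k i a),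
         (marker, - int (Suc i)), (blk k 1, 1 - int k)])"
proof -
  let ?t0 = "in_tape (u @ enc_nat a @ [5]) z"
  let ?v1 = "v @ enc_nat a" and ?v2 = "(v @ enc_nat a) @ [4,2,5]"
  let ?v3 = "?v2 @ concat (map (enc_entry i) [0..<k])"
  have "reaches (length (enc_nat a) + 1)
    (2, [in_tape u (enc_nat a @ 5 # z), out_tape v, (marker, - int i), (blk k x, 1 - int k)])
    (16, [?t0, out_tape ?v1, (marker, - int i), (blk k x, 1 - int k)])"
    by (rule reaches_copy[OF set_enc_nat])
  also have "reaches 3 (16, [?t0, out_tape ?v1, (marker, - int i), (blk k x, 1 - int k)])
    (3, [?t0, out_tape ?v2, (marker, - int i), (blk k x, 1 - int k)])"
    by (rule reaches_emit)
  also have "reaches (6 * k) (3, [?t0, out_tape ?v2, (marker, - int i), (blk k x, 1 - int k)])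
    (3, [?t0, out_tape ?v3, (marker, int k - int i), (blk k x, 1)])"
    using reaches_entries[of 0 k k x i ?t0 ?v2] assms by simp
  also have "reaches (Suc 0) (3, [?t0, out_tape ?v3, (marker, int k - int i), (blk k x, 1)])
    (4, [?t0, out_tape (?v3 @ [6]), (marker, int k - int i - 1),
         (\<lambda>p. if - int 0 < p then blk k 1 p else blk k x p, - int 0)])"
  proof -
    have "(\<lambda>p. if 0 < p then blk k 1 p else blk k x p) = blk k x"
        "blk k x 1 = 0" "(blk k x)(1 := 0) = blk k x"
      by (auto simp: blk_def fun_eq_iff)
    then show ?thesis
      by (intro reaches_step) (simp add: red_step_simps reaches_refl)
  qed
  also have "reaches (Suc k) (4, [?t0, out_tape (?v3 @ [6]), (marker, int k - int i - 1),
         (\<lambda>p. if - int 0 < p then blk k 1 p else blk k x p, - int 0)])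
    (2, [?t0, out_tape (?v3 @ [6]), (marker, int k - int i - 1 - int k), (blk k 1, 1 - int k)])"
    by (rule reaches_return) (use assms in auto)
  finally show ?thesis
    by (simp add: enc_ss_row_def algebra_simps)
qed

fun enc_ss_rows :: "nat \<Rightarrow> nat \<Rightarrow> nat list \<Rightarrow> nat list" where
  "enc_ss_rows k i [] = []"
| "enc_ss_rows k i (a # as) = enc_ss_row k i a @ enc_ss_rows k (Suc i) as"

definition enc_nats :: "nat list \<Rightarrow> nat list" where
  "enc_nats ns = concat (map (\<lambda>a. enc_nat a @ [5]) ns)"

lemma enc_nats_simps [simp]:
  "enc_nats [] = []" "enc_nats (a # as) = enc_nat a @ 5 # enc_nats as"
  by (simp_all add: enc_nats_def)

text \<open>The first return fills the block with 1, the value of \<open>x\<close> required for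
  \<open>Suc i\<close>, so the rows chain by induction; the blank behind the last number halts the
  machine.\<close>

lemma reaches_rows:
  assumes "x = (if i = 0 then 2 else 1)"
  shows "\<exists>t2 t3. reaches (length (enc_nats ns) + length ns * (7 * k + 6) + 1)
    (2, [in_tape u (enc_nats ns), out_tape v, (marker, - int i), (blk k x, 1 - int k)])
    (17, [in_tape (u @ enc_nats ns) [], out_tape (v @ enc_ss_rows k i ns), t2, t3])"
  using assms
proof (induction ns arbitrary: u v i x)
  case Nil
  have "reaches 1 (2, [in_tape u [], out_tape v, (marker, - int i), (blk k x, 1 - int k)])
      (17, [in_tape u [], out_tape v, (marker, - int i), (blk k x, 1 - int k)])"
    by (rule reaches_funpow) (auto simp: red_step_simps in_tape_def out_tape_def word_content_def)
  then show ?case by (auto intro!: exI)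
next
  case (Cons a ns)
  note reaches_row[OF Cons.prems, of a k u "enc_nats ns" v]
  also from Cons.IH[of 1 "Suc i" "u @ enc_nat a @ [5]" "v @ enc_ss_row k i a"]
  obtain t2 t3 where "reaches (length (enc_nats ns) + length ns * (7 * k + 6) + 1)
    (2, [in_tape (u @ enc_nat a @ [5]) (enc_nats ns), out_tape (v @ enc_ss_row k i a),
      (marker, - int (Suc i)), (blk k 1, 1 - int k)])
    (17, [in_tape ((u @ enc_nat a @ [5]) @ enc_nats ns) [],
      out_tape ((v @ enc_ss_row k i a) @ enc_ss_rows k (Suc i) ns), t2, t3])"
    by auto
  finally show ?case
    by (intro exI[of _ t2] exI[of _ t3]) (auto elim!: reaches_mono)
qed

lemma set_enc_nats: "set (enc_nats ns) \<subseteq> {1, 2, 5}"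
  using set_enc_nat by (induction ns) fastforce+

text \<open>No digit is 5, so each number contributes only its terminator. Hence the block on tape 3
  gets one cell per row.\<close>

lemma count_list_enc_nats: "count_list (enc_nats ns) 5 = length ns"
proof (induction ns)
  case (Cons a ns)
  have "count_list (enc_nat a) 5 = 0"
    using set_enc_nat[of a] by (auto simp: count_list_0_iff)
  with Cons show ?case by simp
qed simp

lemma length_le_enc_nats: "length ns \<le> length (enc_nats ns)"
  by (induction ns) auto

text \<open>Counting takes \<open>length w\<close> steps, the turn 1, rewinding
  \<open>length w + 1\<close>, the threshold 5, and the rows with the halting step account for the
  rest.\<close>

lemma reaches_reduction:
  fixes ns :: "nat list"
  defines "w \<equiv> enc_nats ns" and "k \<equiv> length ns"
  shows "\<exists>t0 t2 t3. reaches (3 * length w + k * (7 * k + 6) + 8) (tm_init red_tm w)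
    (17, [t0, out_tape ([2,4,1,2,5] @ enc_ss_rows k 0 ns), t2, t3])"
proof -
  have w0: "0 \<notin> set w" using set_enc_nats[of ns] by (auto simp: w_def)
  have "word_content [] = blk 0 2"
    by (auto simp: word_content_def blk_def fun_eq_iff)
  then have init: "tm_init red_tm w =
      (0, [in_tape [] w, out_tape [], (word_content [], 0), (blk 0 2, - int 0)])"
    by (simp add: tm_init_def red_tm_def in_tape_def out_tape_def numeral_eq_Suc)
  have "reaches (length w) (tm_init red_tm w)
      (0, [in_tape w [], out_tape [], (word_content [], 0), (blk k 2, - int k)])"
    using reaches_count[OF w0, of "[]" "out_tape []" "(word_content [], 0)" 0] count_list_enc_nats[of ns]
    unfolding init by (simp add: w_def k_def)
  also have "reaches (Suc 0)
      (0, [in_tape w [], out_tape [], (word_content [], 0), (blk k 2, - int k)])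
      (1, [(word_content w, int (length w) - 1), out_tape [], (marker, 0), (blk k 2, 1 - int k)])"
  proof -
    have "(word_content w)(int (length w) := 0) = word_content w" "word_content w (int (length w)) = 0"
      "(word_content [])(0 := 1) = marker" "blk k 2 (- int k) = 0" "(blk k 2)(- int k := 0) = blk k 2"
      by (auto simp: word_content_def marker_def blk_def fun_eq_iff)
    then show ?thesis
      by (intro reaches_step) (simp add: red_step_simps reaches_refl in_tape_def out_tape_def)
  qed
  also have "reaches (Suc (length w))
      (1, [(word_content w, int (length w) - 1), out_tape [], (marker, 0), (blk k 2, 1 - int k)])
      (5, [in_tape [] w, out_tape [], (marker, 0), (blk k 2, 1 - int k)])"
    by (rule reaches_rewind[OF w0]) simp
  also have "reaches 5 (5, [in_tape [] w, out_tape [], (marker, 0), (blk k 2, 1 - int k)])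
      (2, [in_tape [] w, out_tape ([] @ [2,4,1,2,5]), (marker, - int 0), (blk k 2, 1 - int k)])"
    using reaches_emit(1)[of _ "[]"] by simp
  also obtain t2 t3 where "reaches (length w + k * (7 * k + 6) + 1)
      (2, [in_tape [] w, out_tape ([] @ [2,4,1,2,5]), (marker, - int 0), (blk k 2, 1 - int k)])
      (17, [in_tape ([] @ w) [], out_tape (([] @ [2,4,1,2,5]) @ enc_ss_rows k 0 ns), t2, t3])"
    using reaches_rows[of 2 0 ns k "[]" "[] @ [2,4,1,2,5]"] by (auto simp: w_def k_def)
  finally show ?thesis
    by (intro exI[of _ "in_tape ([] @ w) []"] exI[of _ t2] exI[of _ t3]) (auto elim!: reaches_mono)
qed

section \<open>The machine computes the reduction\<close>

lemma enc_rat_simps: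
  "enc_rat 0 = [4, 2]" "enc_rat 1 = [2, 4, 2]" "enc_rat (1/2) = [2, 4, 1, 2]"
  "enc_rat (of_nat a) = enc_nat a @ [4, 2]"
proof -
  have half: "quotient_of (1/2) = (1, 2)"
    using quotient_of_Fract[of 1 2] by (simp add: Fract_of_int_quotient Rat.normalize_def)
  have "enc_nat 0 = []" "enc_nat 1 = [2]" "enc_nat 2 = [1, 2]"
    by (simp_all add: enc_nat.simps)
  then show "enc_rat 0 = [4, 2]" "enc_rat 1 = [2, 4, 2]" "enc_rat (1/2) = [2, 4, 1, 2]"
    "enc_rat (of_nat a) = enc_nat a @ [4, 2]"
    unfolding enc_rat_def half by (simp_all add: enc_int_def)
qed

lemma enc_rat_vec_ss_row: "enc_rat_vec (ss_row ns i) = enc_ss_row (length ns) i (ns ! i)"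
proof -
  have "list_of_vec (ss_row ns i) = of_nat (ns ! i) #
      map (\<lambda>j. if i = 0 then 1/2 else if j = i then 1 else 0) [0..<length ns]"
    unfolding ss_row_def by (rule nth_equalityI) (auto simp: nth_Cons' simp del: upt_Suc)
  moreover have "enc_rat (if i = 0 then 1/2 else if j = i then 1 else 0) @ [5] = enc_entry i j" for j
    by (simp add: enc_rat_simps enc_entry_def)
  ultimately show ?thesis
    by (simp add: enc_rat_vec_def enc_ss_row_def enc_rat_simps comp_def)
qed

text \<open>The recursion follows the machine from number to number; the indexed form matches the
  list of basis vectors.\<close>

lemma enc_ss_rows_eq:
  "enc_ss_rows k i ns = concat (map (\<lambda>j. enc_ss_row k (i + j) (ns ! j)) [0..<length ns])"
proof (induction ns arbitrary: i)
  case (Cons a ns)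
  have "[0..<length (a # ns)] = 0 # map Suc [0..<length ns]"
    by (simp add: map_Suc_upt upt_conv_Cons del: upt_Suc)
  then show ?case by (simp add: Cons comp_def)
qed simp

lemma enc_ss_to_gapsvp:
  "enc_gapsvp (ss_to_gapsvp (s, as)) =
     [2,4,1,2,5] @ enc_ss_rows (Suc (length as)) 0 (s # as)"
  by (simp add: enc_gapsvp_def ss_to_gapsvp_def enc_rat_simps enc_ss_rows_eq comp_def
      enc_rat_vec_ss_row del: upt_Suc)

lemma set_enc_ss_rows: "set (enc_ss_rows k i ns) \<subseteq> {1..<7}"
proof -
  have "set (enc_ss_row k i a) \<subseteq> {1..<7}" for i a
    using set_enc_nat[of a] by (auto simp: enc_ss_row_def enc_entry_def)
  then show ?thesis unfolding enc_ss_rows_eq by fastforce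
qed

lemma enc_ss_eq: "enc_ss (s, as) = enc_nats (s # as)"
  by (simp add: enc_ss_def enc_nats_def)

lemma polytime_ss_to_gapsvp: "polytime_computable_on A enc_ss enc_gapsvp ss_to_gapsvp"
  unfolding polytime_computable_on_def
proof (intro exI conjI ballI)
  fix x :: ss_instance
  obtain s as where x: "x = (s, as)" by (cases x)
  let ?w = "enc_ss x" and ?k = "length (s # as)"
  show "set ?w \<union> set (enc_gapsvp (ss_to_gapsvp x)) \<subseteq> {1..<tm_symbols red_tm}"
    using set_enc_nats[of "s # as"] set_enc_ss_rows[of ?k 0 "s # as"]
    by (auto simp: x enc_ss_eq enc_ss_to_gapsvp red_tm_def simp del: enc_nats_simps enc_ss_rows.simps)
  have "?k \<le> length ?w"
    unfolding x enc_ss_eq by (rule length_le_enc_nats)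
  then have "?k * (7 * ?k + 6) \<le> length ?w * (7 * length ?w + 6)"
    by (intro mult_le_mono add_le_mono order_refl)
  \<comment> \<open>The polynomial \<open>8 + 9 * n + 7 * n^2\<close> arises from the time bound by
    replacing \<open>?k\<close> by the input length \<open>n\<close>.\<close>
  then have time: "3 * length ?w + ?k * (7 * ?k + 6) + 8 \<le> poly [:8, 9, 7:] (length ?w)"
    by (simp add: algebra_simps)
  obtain t0 t2 t3 where "reaches (3 * length ?w + ?k * (7 * ?k + 6) + 8) (tm_init red_tm ?w)
      (17, [t0, out_tape (enc_gapsvp (ss_to_gapsvp x)), t2, t3])"
    using reaches_reduction[of "s # as"]
    unfolding x enc_ss_eq enc_ss_to_gapsvp length_Cons by blast
  then have "(tm_step red_tm ^^ poly [:8, 9, 7:] (length ?w)) (tm_init red_tm ?w) =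
      (17, [t0, out_tape (enc_gapsvp (ss_to_gapsvp x)), t2, t3])"
    by (intro reaches_halted_exact reaches_mono[OF _ time])
  then show "tm_outputs_within red_tm ?w (enc_gapsvp (ss_to_gapsvp x))
      (poly [:8, 9, 7:] (length ?w))"
    unfolding tm_outputs_within_def by (simp add: red_tm_def out_tape_def)
qed (rule tm_wf_red_tm)

theorem theorem1p5:
  fixes \<epsilon> :: real
  assumes "0 < \<epsilon>" and "\<epsilon> \<le> 1"
  shows "\<exists>(f :: ss_instance \<Rightarrow> gapsvp_instance) (C :: nat).
           karp_reduction enc_ss SS enc_gapsvp (GapSVP_inf (2 - \<epsilon>)) f \<and>
           (\<forall>s as. 0 < s \<and> 0 < length as \<longrightarrow> lattice_rank (f (s, as)) \<le> C * length as)"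
proof (intro exI conjI)
  show "karp_reduction enc_ss SS enc_gapsvp (GapSVP_inf (2 - \<epsilon>)) ss_to_gapsvp"
    using ss_to_gapsvp_correct[OF assms(1)] polytime_ss_to_gapsvp
    by (auto simp: karp_reduction_def)
  \<comment> \<open>The rank is \<open>n + 1\<close>, and \<open>n + 1 \<le> 2 * n\<close> for
    \<open>n \<ge> 1\<close>, so the constant 2 serves every \<open>\<epsilon>\<close>.\<close>
  show "\<forall>s as. 0 < s \<and> 0 < length as \<longrightarrow> lattice_rank (ss_to_gapsvp (s, as)) \<le> 2 * length as"
    by (auto simp: lattice_rank_ss_to_gapsvp Suc_le_eq)
qed

end
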